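(* Let $t\ge 1$ and for $i=1,\dots,t$ let $C_{k_i}^{p_i}$ be an oriented cycle on $k_i$ vertices with $p_i$ sources and $p_i$ sinks. The direct product $C_{k_1}^{p_1}\times\cdots\times C_{k_t}^{p_t}$ is an ECD digraph if and only if at most one of $p_1,\dots,p_t$ is nonzero and, moreover: (i) if $p_1=\cdots=p_t=0$, then at least one of $k_1,\ldots,k_t$ is even; (ii) if $p_j>0$ for some (necessarily unique) $j$, then in $C_{k_j}^{p_j}$ every sink is at even distance to at least one of its neighboring sources.
   Context: A digraph's vertex $v$ is a source if it has in-degree $0$ and a sink if it has out-degree $0$. An oriented cycle $C_k^p$ is a cycle on $k$ vertices each of whose edges is given one orientation, having $p$ sources and $p$ sinks; $C_k^0$ is the directed cycle. In an oriented cycle, a source $v$ is a neighboring source of a vertex $u$ if there is a directed path from $v$ to $u$ (containing no sink except possibly $u$); the distance between a vertex and a neighboring source is the length of that path (which contains no other sources or sinks). The direct product $D\times F$ has vertex set $V(D)\times V(F)$ and an arc from $(d,f)$ to $(d',f')$ iff $(d,d')\in A(D)$ and $(f,f')\in A(F)$. With $N^+_D[v]=\{v\}\cup\{u:(v,u)\in A(D)\}$, a set $S$ is an ECD set of $D$ if $\{N^+_D[v]:v\in S\}$ is a partition of $V(D)$, and $D$ is an ECD digraph if it has an ECD set. *)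

theory Defs
  imports
    "Graph_Theory.Pair_Digraph"
    "HOL-Library.FuncSet"
    "HOL-Library.Disjoint_Sets"
begin

definition source :: "'a pair_pre_digraph \<Rightarrow> 'a \<Rightarrow> bool" where
  "source D v \<longleftrightarrow> v \<in> pverts D \<and> in_degree D v = 0"

definition sink :: "'a pair_pre_digraph \<Rightarrow> 'a \<Rightarrow> bool" where
  "sink D v \<longleftrightarrow> v \<in> pverts D \<and> out_degree D v = 0"

(* The vertices x 0, ..., x (k - 1) are listed in cyclic order, and fwd i tells whether the
   edge between x i and its successor is oriented forwards. As the underlying cycle is a cycle
   of a simple graph, k >= 3. *)
definition oriented_cycle :: "'a pair_pre_digraph \<Rightarrow> nat \<Rightarrow> nat \<Rightarrow> bool" where
  "oriented_cycle D k p \<longleftrightarrow>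
     k \<ge> 3 \<and>
     (\<exists>(x :: nat \<Rightarrow> 'a) (fwd :: nat \<Rightarrow> bool).
        bij_betw x {..<k} (pverts D) \<and>
        parcs D = {(if fwd i then (x i, x (Suc i mod k)) else (x (Suc i mod k), x i)) | i. i < k}) \<and>
     card {v. source D v} = p \<and>
     card {v. sink D v} = p"

(* A directed path from the source v to u with arc list es. Stated through paths rather than
   through a distance function, because when the cycle has a single source, two such paths of
   different lengths can join the same pair of vertices. *)
definition source_path ::
  "'a pair_pre_digraph \<Rightarrow> 'a \<Rightarrow> ('a \<times> 'a) list \<Rightarrow> 'a \<Rightarrow> bool" where
  "source_path D v es u \<longleftrightarrow>
     source D v \<and>
     pre_digraph.apath D v es u \<and>
     (\<forall>w \<in> set (pre_digraph.awalk_verts D v es). sink D w \<longrightarrow> w = u) \<and>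
     (\<forall>w \<in> set (pre_digraph.awalk_verts D v es). source D w \<longrightarrow> w = v)"

definition neighboring_source :: "'a pair_pre_digraph \<Rightarrow> 'a \<Rightarrow> 'a \<Rightarrow> bool" where
  "neighboring_source D v u \<longleftrightarrow> (\<exists>es. source_path D v es u)"

definition at_source_distance :: "'a pair_pre_digraph \<Rightarrow> 'a \<Rightarrow> 'a \<Rightarrow> nat \<Rightarrow> bool" where
  "at_source_distance D v u n \<longleftrightarrow> (\<exists>es. source_path D v es u \<and> length es = n)"

definition direct_product ::
  "'a pair_pre_digraph \<Rightarrow> 'b pair_pre_digraph \<Rightarrow> ('a \<times> 'b) pair_pre_digraph" where
  "direct_product D F =
     \<lparr> pverts = pverts D \<times> pverts F,
       parcs = {((d, f), (d', f')) | d f d' f'. (d, d') \<in> parcs D \<and> (f, f') \<in> parcs F} \<rparr>"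

(* The product of a finite family, with tuples as extensional functions on the index set.
   It is the iterated binary product up to isomorphism: see the two lemmas below. *)
definition direct_product_family ::
  "'i set \<Rightarrow> ('i \<Rightarrow> 'a pair_pre_digraph) \<Rightarrow> ('i \<Rightarrow> 'a) pair_pre_digraph" where
  "direct_product_family I D =
     \<lparr> pverts = (\<Pi>\<^sub>E i\<in>I. pverts (D i)),
       parcs = {(f, g). f \<in> (\<Pi>\<^sub>E i\<in>I. pverts (D i)) \<and> g \<in> (\<Pi>\<^sub>E i\<in>I. pverts (D i)) \<and>
                        (\<forall>i\<in>I. (f i, g i) \<in> parcs (D i))} \<rparr>"

lemma direct_product_family_singleton:
  "bij_betw (\<lambda>f. f i) (pverts (direct_product_family {i} D)) (pverts (D i))"
  "\<lbrakk>f \<in> pverts (direct_product_family {i} D); g \<in> pverts (direct_product_family {i} D)\<rbrakk> \<Longrightarrow>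
     (f, g) \<in> parcs (direct_product_family {i} D) \<longleftrightarrow> (f i, g i) \<in> parcs (D i)"
proof -
  show "bij_betw (\<lambda>f. f i) (pverts (direct_product_family {i} D)) (pverts (D i))"
    by (rule bij_betw_byWitness[where f' = "\<lambda>a. \<lambda>j\<in>{i}. a"])
       (auto simp: direct_product_family_def fun_eq_iff PiE_iff extensional_def
         split: if_splits)
qed (auto simp: direct_product_family_def)

lemma direct_product_family_insert:
  assumes "i \<notin> I"
  shows
    "bij_betw (\<lambda>f. (f i, restrict f I)) (pverts (direct_product_family (insert i I) D))
       (pverts (direct_product (D i) (direct_product_family I D)))"
    "\<lbrakk>f \<in> pverts (direct_product_family (insert i I) D);
      g \<in> pverts (direct_product_family (insert i I) D)\<rbrakk> \<Longrightarrow>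
       (f, g) \<in> parcs (direct_product_family (insert i I) D) \<longleftrightarrow>
       ((f i, restrict f I), (g i, restrict g I))
         \<in> parcs (direct_product (D i) (direct_product_family I D))"
proof -
  show "bij_betw (\<lambda>f. (f i, restrict f I)) (pverts (direct_product_family (insert i I) D))
       (pverts (direct_product (D i) (direct_product_family I D)))"
    using assms
    by (intro bij_betw_byWitness[where f' = "\<lambda>(a, f). f(i := a)"])
       (auto simp: direct_product_family_def direct_product_def fun_eq_iff PiE_iff extensional_def
         split: if_splits)
qed (auto simp: direct_product_family_def direct_product_def PiE_iff)

definition closed_out_nbhd :: "'a pair_pre_digraph \<Rightarrow> 'a \<Rightarrow> 'a set" where
  "closed_out_nbhd D v = insert v {u. (v, u) \<in> parcs D}"

definition ECD_set :: "'a pair_pre_digraph \<Rightarrow> 'a set \<Rightarrow> bool" where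
  "ECD_set D S \<longleftrightarrow> S \<subseteq> pverts D \<and> partition_on (pverts D) (closed_out_nbhd D ` S)"

definition ECD_digraph :: "'a pair_pre_digraph \<Rightarrow> bool" where
  "ECD_digraph D \<longleftrightarrow> (\<exists>S. ECD_set D S)"

end

theory Submission
  imports Defs
begin

text \<open>
  A set is an ECD set iff every vertex is dominated exactly once. If two factors have sources,
  then, with \<open>s\<close> a source of one of them, \<open>s \<rightarrow> w\<close> an arc, and \<open>c\<close>, \<open>d\<close> the two in-neighbours of
  a sink \<open>z\<close> of the other, \<open>(s, c, \<dots>)\<close> and \<open>(s, d, \<dots>)\<close> are sources of the product, hence belong
  to every ECD set, but both dominate \<open>(w, z, \<dots>)\<close>. If all other factors are directed cycles, the
  in-neighbours of a vertex of the product correspond to those of its \<open>j\<close>-th coordinate: ECD sets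
  of that factor pull back, and membership of a vertex in an ECD set alternates along arcs up to
  the sinks, starting from the sources. Around a directed cycle the alternation needs even length;
  if all \<open>k\<^sub>i\<close> are odd, the diagonal closed walk in the product has odd length.
\<close>

section \<open>ECD sets as exact domination\<close>

lemma ECD_set_iff:
  assumes "asym (parcs D)" and "parcs D \<subseteq> pverts D \<times> pverts D"
  shows "ECD_set D S \<longleftrightarrow>
    S \<subseteq> pverts D \<and> (\<forall>v\<in>pverts D. \<exists>!u. u \<in> S \<and> v \<in> closed_out_nbhd D u)"
proof -
  let ?N = "closed_out_nbhd D"
  \<comment> \<open>A partition sees only the set of neighbourhoods, so two chosen vertices with the
    same neighbourhood would go unnoticed. Asymmetry rules this out, since each of the two would
    have an arc to the other.\<close>
  have inj: "u = u'" if "?N u = ?N u'" for u u'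
  proof (rule ccontr)
    assume "u \<noteq> u'"
    moreover have "u \<in> ?N u'" "u' \<in> ?N u"
      using that by (auto simp: closed_out_nbhd_def)
    ultimately have "(u', u) \<in> parcs D" "(u, u') \<in> parcs D"
      by (auto simp: closed_out_nbhd_def)
    then show False using asymD[OF assms(1)] by blast
  qed
  show ?thesis
  proof (cases "S \<subseteq> pverts D")
    case True
    then have "(\<Union>u\<in>S. ?N u) \<subseteq> pverts D"
      using assms(2) by (auto simp: closed_out_nbhd_def)
    then have union: "(\<Union>u\<in>S. ?N u) = pverts D \<longleftrightarrow> (\<forall>v\<in>pverts D. \<exists>u\<in>S. v \<in> ?N u)"
      by blast
    have disj: "disjoint (?N ` S) \<longleftrightarrow> (\<forall>u\<in>S. \<forall>u'\<in>S. u \<noteq> u' \<longrightarrow> ?N u \<inter> ?N u' = {})"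
    proof -
      have "?N u \<noteq> ?N u' \<longleftrightarrow> u \<noteq> u'" for u u'
        using inj by blast
      then show ?thesis
        unfolding disjoint_def ball_simps by simp
    qed
    have "{} \<notin> ?N ` S"
      by (auto simp: closed_out_nbhd_def)
    then have "ECD_set D S \<longleftrightarrow> (\<forall>v\<in>pverts D. \<exists>u\<in>S. v \<in> ?N u) \<and>
      (\<forall>u\<in>S. \<forall>u'\<in>S. u \<noteq> u' \<longrightarrow> ?N u \<inter> ?N u' = {})"
      unfolding ECD_set_def partition_on_def using union disj True by blast
    also have "\<dots> \<longleftrightarrow> (\<forall>v\<in>pverts D. \<exists>!u. u \<in> S \<and> v \<in> ?N u)"
    proof (intro iffI conjI ballI impI)
      fix u u' assume uniq: "\<forall>v\<in>pverts D. \<exists>!u. u \<in> S \<and> v \<in> ?N u"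
        and u: "u \<in> S" "u' \<in> S" "u \<noteq> u'"
      have "v \<in> pverts D" if "v \<in> ?N u" for v
        using that True assms(2) u by (auto simp: closed_out_nbhd_def)
      then show "?N u \<inter> ?N u' = {}" using uniq u by blast
    qed blast+
    finally show ?thesis using True by simp
  qed (simp add: ECD_set_def)
qed

locale ECD_digraph_set =
  fixes D :: "'a pair_pre_digraph" and S :: "'a set"
  assumes arcs_verts: "parcs D \<subseteq> pverts D \<times> pverts D"
    and asym_arcs: "asym (parcs D)"
    and ECD: "ECD_set D S"
begin

lemma dominated: "v \<in> pverts D \<Longrightarrow> \<exists>!u. u \<in> S \<and> v \<in> closed_out_nbhd D u"
  using ECD unfolding ECD_set_iff[OF asym_arcs arcs_verts] by simp

lemma no_in_arc_mem:
  assumes "v \<in> pverts D" "\<And>u. (u, v) \<notin> parcs D"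
  shows "v \<in> S"
proof -
  have "v \<in> closed_out_nbhd D w \<longleftrightarrow> w = v" for w
    using assms(2) by (auto simp: closed_out_nbhd_def)
  then show ?thesis using dominated[OF assms(1)] by auto
qed

text \<open>Only \<open>u\<close> and \<open>v\<close> dominate \<open>v\<close>, so exactly one of
  them is chosen; this drives the parity arguments for necessity.\<close>

lemma unique_in_arc_mem:
  assumes "(u, v) \<in> parcs D" "\<And>u'. (u', v) \<in> parcs D \<Longrightarrow> u' = u"
  shows "v \<in> S \<longleftrightarrow> u \<notin> S"
proof -
  have v: "v \<in> pverts D" and "u \<noteq> v"
    using assms(1) arcs_verts asymD[OF asym_arcs, of u v] by auto
  have nb: "v \<in> closed_out_nbhd D w \<longleftrightarrow> w = v \<or> w = u" for w
    unfolding closed_out_nbhd_def using assms(1) assms(2)[of w] by auto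
  obtain w where "w \<in> S" "w = v \<or> w = u"
    and uniq: "\<And>w'. w' \<in> S \<Longrightarrow> w' = v \<or> w' = u \<Longrightarrow> w' = w"
    using dominated[OF v] unfolding nb by blast
  then show ?thesis
    using uniq[of u] uniq[of v] \<open>u \<noteq> v\<close> by blast
qed

lemma in_arcs_mem_eq:
  assumes "(u, v) \<in> parcs D" "(u', v) \<in> parcs D" "u \<in> S" "u' \<in> S"
  shows "u = u'"
proof -
  have "v \<in> pverts D" "v \<in> closed_out_nbhd D u" "v \<in> closed_out_nbhd D u'"
    using assms arcs_verts by (auto simp: closed_out_nbhd_def)
  then show ?thesis
    using dominated assms(3,4) by blast
qed

end

section \<open>Walks and paths from sources\<close>

text \<open>Lengths of arbitrary walks from a source, free of the distinctness conditions in
  \<open>source_path\<close>. This is a relation and not a function because a sink can be reached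
  from both sides with different lengths.\<close>

inductive source_depth :: "'a pair_pre_digraph \<Rightarrow> 'a \<Rightarrow> nat \<Rightarrow> bool"
  for D where
  source: "source D v \<Longrightarrow> source_depth D v 0"
| step: "source_depth D u n \<Longrightarrow> (u, v) \<in> parcs D \<Longrightarrow> source_depth D v (Suc n)"

lemma source_depth_walk:
  assumes "source_depth D u m" "pcas u es v" "set es \<subseteq> parcs D"
  shows "source_depth D v (m + length es)"
  using assms
proof (induction es arbitrary: u m)
  case (Cons e es)
  have "source_depth D (snd e) (Suc m)"
    using Cons.prems by (cases e) (auto intro: source_depth.step)
  from Cons.IH[OF this] Cons.prems show ?case by simp
qed simp

lemma pawalk_verts_snoc: "pawalk_verts s (es @ [(u, v)]) = pawalk_verts s es @ [v]"
  if "pcas s es u"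
  using that by (induction es arbitrary: s) auto

lemma pcas_snoc: "pcas s (es @ [(u, v)]) v \<longleftrightarrow> pcas s es u"
  by (induction es arbitrary: s) auto

text \<open>Passes to the recursive walk notions on pairs; \<open>source D s\<close> accounts for
  the start being a vertex.\<close>

lemma source_path_iff:
  "source_path D s es u \<longleftrightarrow> source D s \<and> set es \<subseteq> parcs D \<and> pcas s es u \<and>
     distinct (pawalk_verts s es) \<and>
     (\<forall>w \<in> set (pawalk_verts s es). sink D w \<longrightarrow> w = u) \<and>
     (\<forall>w \<in> set (pawalk_verts s es). source D w \<longrightarrow> w = s)"
  unfolding source_path_def pre_digraph.apath_def pre_digraph.awalk_def
    cas_with_proj_eq awalk_verts_with_proj_eq
  by (auto simp: source_def)

section \<open>Oriented cycles with integer indices\<close>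

text \<open>The integer indexing, periodic with period \<open>k\<close>, avoids arithmetic modulo \<open>k\<close>.\<close>

locale int_cycle =
  fixes D :: "'a pair_pre_digraph" and k :: nat and X :: "int \<Rightarrow> 'a" and F :: "int \<Rightarrow> bool"
  assumes k3: "k \<ge> 3"
    and verts: "pverts D = range X"
    and X_eq_iff: "X i = X j \<longleftrightarrow> int k dvd i - j"
    and F_cong: "X i = X j \<Longrightarrow> F i = F j"
    and arcs: "parcs D = {if F i then (X i, X (i + 1)) else (X (i + 1), X i) | i. True}"
begin

lemma X_pred_succ: "X i = X j \<Longrightarrow> X (i + d) = X (j + d)" "X i = X j \<Longrightarrow> X (i - d) = X (j - d)"
  by (simp_all add: X_eq_iff)

text \<open>Since \<open>k\<close> is at least 3, it divides neither 1 nor 2.\<close>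

lemma X_near:
  "X i \<noteq> X (i + 1)" "X (i + 1) \<noteq> X i" "X i \<noteq> X (i - 1)" "X (i - 1) \<noteq> X i"
  "X (i - 1) \<noteq> X (i + 1)" "X (i + 1) \<noteq> X (i - 1)"
  using k3 zdvd_imp_le[of "int k" 1] zdvd_imp_le[of "int k" 2] by (auto simp: X_eq_iff)

text \<open>The edges at \<open>X i\<close> have indices \<open>i - 1\<close> and \<open>i\<close>.
  An arc may be given under a congruent index \<open>j\<close>; \<open>F_cong\<close> carries the
  orientation over.\<close>

lemma in_arc_iff:
  "(u, X i) \<in> parcs D \<longleftrightarrow> u = X (i - 1) \<and> F (i - 1) \<or> u = X (i + 1) \<and> \<not> F i"
proof
  assume "(u, X i) \<in> parcs D"
  then obtain j where "(u, X i) = (if F j then (X j, X (j + 1)) else (X (j + 1), X j))"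
    unfolding arcs by blast
  then consider "F j" "u = X j" "X i = X (j + 1)" | "\<not> F j" "u = X (j + 1)" "X i = X j"
    by (auto split: if_splits)
  then show "u = X (i - 1) \<and> F (i - 1) \<or> u = X (i + 1) \<and> \<not> F i"
  proof cases
    case 1
    then have "X (i - 1) = X j" using X_pred_succ(2)[of i "j + 1" 1] by simp
    then show ?thesis using 1 F_cong[of "i - 1" j] by auto
  next
    case 2
    then show ?thesis using F_cong[of i j] X_pred_succ(1)[of i j 1] by auto
  qed
next
  show "u = X (i - 1) \<and> F (i - 1) \<or> u = X (i + 1) \<and> \<not> F i \<Longrightarrow> (u, X i) \<in> parcs D"
    unfolding arcs by (auto intro: exI[of _ "i - 1"] exI[of _ i])
qed

lemma out_arc_iff:
  "(X i, u) \<in> parcs D \<longleftrightarrow> u = X (i + 1) \<and> F i \<or> u = X (i - 1) \<and> \<not> F (i - 1)"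
proof -
  have "(X i, u) \<in> parcs D \<Longrightarrow> u \<in> range X"
    unfolding arcs by (auto split: if_splits)
  then show ?thesis
  proof (cases "u \<in> range X")
    case True
    then obtain l where R: "u = X l" by (rule rangeE)
    have a: "X i = X (l - 1) \<longleftrightarrow> u = X (i + 1)" "X i = X (l + 1) \<longleftrightarrow> u = X (i - 1)"
      unfolding R X_eq_iff by (subst dvd_minus_iff[symmetric], simp add: algebra_simps)+
    have b: "X i = X (l - 1) \<Longrightarrow> F (l - 1) = F i" by (rule F_cong) simp
    have c: "u = X (i - 1) \<Longrightarrow> F l = F (i - 1)" by (rule F_cong) (simp add: R)
    have "(X i, u) \<in> parcs D \<longleftrightarrow> X i = X (l - 1) \<and> F (l - 1) \<or> X i = X (l + 1) \<and> \<not> F l"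
      unfolding R by (rule in_arc_iff)
    then show ?thesis using a b c by metis
  qed blast
qed

lemma finite_verts: "finite (pverts D)"
proof -
  have "pverts D \<subseteq> X ` {0..<int k}"
  proof
    fix v assume "v \<in> pverts D"
    then obtain i where "v = X i" using verts by auto
    then have "v = X (i mod int k)" by (simp add: X_eq_iff mod_eq_dvd_iff[symmetric])
    then show "v \<in> X ` {0..<int k}" using k3 by auto
  qed
  then show ?thesis by (rule finite_subset) simp
qed

lemma arcs_verts: "parcs D \<subseteq> pverts D \<times> pverts D"
  unfolding arcs verts by auto

lemma finite_arcs: "finite (parcs D)"
  using finite_subset[OF arcs_verts] finite_verts by auto

lemma asym_arcs: "asym (parcs D)"
proof (rule asymI)
  fix u v assume uv: "(u, v) \<in> parcs D"
  then obtain i where v: "v = X i" using arcs_verts verts by auto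
  show "(v, u) \<notin> parcs D"
    using uv X_near[of i] unfolding v in_arc_iff out_arc_iff by auto
qed

lemma source_iff: "source D v \<longleftrightarrow> v \<in> pverts D \<and> (\<forall>u. (u, v) \<notin> parcs D)"
proof -
  have "in_arcs D v = {e \<in> parcs D. snd e = v}" by (auto simp: in_arcs_def)
  then show ?thesis
    unfolding source_def in_degree_def using finite_arcs by (auto simp: card_eq_0_iff)
qed

lemma sink_iff: "sink D v \<longleftrightarrow> v \<in> pverts D \<and> (\<forall>u. (v, u) \<notin> parcs D)"
proof -
  have "out_arcs D v = {e \<in> parcs D. fst e = v}" by (auto simp: out_arcs_def)
  then show ?thesis
    unfolding sink_def out_degree_def using finite_arcs by (auto simp: card_eq_0_iff)
qed

text \<open>If \<open>u\<close> and \<open>u'\<close> differed, both edges at \<open>v\<close> would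
  point inwards and \<open>v\<close> would be a sink.\<close>

lemma unique_in_arc:
  assumes "v \<in> pverts D" "\<not> sink D v" "(u, v) \<in> parcs D" "(u', v) \<in> parcs D"
  shows "u = u'"
proof -
  obtain i where v: "v = X i" using assms(1) verts by auto
  show ?thesis
    using assms unfolding v sink_iff in_arc_iff out_arc_iff by auto
qed

lemma sink_in_arcs:
  assumes "sink D v"
  obtains a b where "a \<noteq> b" "\<And>u. (u, v) \<in> parcs D \<longleftrightarrow> u = a \<or> u = b"
proof -
  obtain i where v: "v = X i" using assms verts by (auto simp: sink_iff)
  have "F (i - 1)" "\<not> F i" using assms unfolding v sink_iff out_arc_iff by auto
  then have "(u, v) \<in> parcs D \<longleftrightarrow> u = X (i - 1) \<or> u = X (i + 1)" for u
    unfolding v in_arc_iff by auto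
  then show thesis using that X_near(5) by blast
qed

text \<open>Traversing the cycle the other way lets statements about forward edges be applied to
  backward ones. The edge with new index \<open>i\<close> joins \<open>X (- i)\<close> to
  \<open>X (- i - 1)\<close>: it is the old edge \<open>- i - 1\<close> run in reverse, hence the
  negation of \<open>F\<close>.\<close>

lemma reflect: "int_cycle D k (\<lambda>i. X (- i)) (\<lambda>i. \<not> F (- i - 1))"
proof
  show "pverts D = range (\<lambda>i. X (- i))"
    unfolding verts by (auto simp: image_def) (metis minus_minus)
  show "X (- i) = X (- j) \<longleftrightarrow> int k dvd i - j" for i j
    unfolding X_eq_iff by (metis dvd_minus_iff minus_diff_eq minus_diff_minus)
  show "(\<not> F (- i - 1)) = (\<not> F (- j - 1))" if "X (- i) = X (- j)" for i j
    using F_cong[OF X_pred_succ(2)[OF that]] by simp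
  show "parcs D = {if \<not> F (- i - 1) then (X (- i), X (- (i + 1))) else (X (- (i + 1)), X (- i)) |i. True}"
    (is "_ = ?R")
  proof -
    have "?R = {if F i then (X i, X (i + 1)) else (X (i + 1), X i) | i. True}" (is "_ = ?L")
    proof (intro equalityI subsetI)
      fix e assume "e \<in> ?R"
      then obtain i where "e = (if \<not> F (- i - 1) then (X (- i), X (- (i + 1))) else (X (- (i + 1)), X (- i)))"
        by blast
      then show "e \<in> ?L" by (intro CollectI exI[of _ "- i - 1"]) simp
    next
      fix e assume "e \<in> ?L"
      then obtain i where "e = (if F i then (X i, X (i + 1)) else (X (i + 1), X i))"
        by blast
      then show "e \<in> ?R" by (intro CollectI exI[of _ "- i - 1"]) (simp add: add.commute)
    qed
    then show ?thesis unfolding arcs by simp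
  qed
qed (use k3 in auto)

text \<open>By periodicity it suffices to go backwards: after \<open>(i - j) mod k\<close> steps the
  index is congruent to \<open>j\<close>.\<close>

lemma backward_all:
  assumes "F i" "\<And>i. F i \<Longrightarrow> F (i - 1)"
  shows "F j"
proof -
  have iter: "F (i - int n)" for n
  proof (induction n)
    case (Suc n)
    show ?case using assms(2)[OF Suc] by (simp add: algebra_simps)
  qed (simp add: assms(1))
  have "F (i - int (nat ((i - j) mod int k)))" by (rule iter)
  moreover have "X (i - int (nat ((i - j) mod int k))) = X j"
    using k3 unfolding X_eq_iff
    by (simp add: mod_eq_dvd_iff[symmetric] mod_simps)
  ultimately show ?thesis using F_cong by blast
qed

section \<open>Depths in a cycle with a source\<close>

text \<open>If the head of a forward edge had no depth, neither would its tail, which is then not a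
  source and so is entered by the preceding edge, again forward. Continued round the whole cycle,
  this would give the source \<open>s\<close> an in-arc.\<close>

lemma source_depth_exists_forward:
  assumes "source D s" "F i"
  shows "\<exists>n. source_depth D (X (i + 1)) n"
proof (rule ccontr)
  define B where "B i \<longleftrightarrow> F i \<and> (\<nexists>n. source_depth D (X (i + 1)) n)" for i
  assume "\<not> ?thesis"
  then have "B i" using assms by (simp add: B_def)
  have step: "B (i - 1)" if "B i" for i
  proof -
    have "(X i, X (i + 1)) \<in> parcs D" using that out_arc_iff by (simp add: B_def)
    then have no: "\<nexists>n. source_depth D (X i) n"
      using that unfolding B_def by (metis source_depth.step)
    then have "\<not> source D (X i)" by (metis source_depth.source)
    then have "F (i - 1)"
      using that unfolding source_iff in_arc_iff B_def by (auto simp: verts)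
    then show ?thesis using no by (simp add: B_def)
  qed
  have B_cong: "B i = B j" if "X i = X j" for i j
    using F_cong[OF that] X_pred_succ(1)[OF that] by (simp add: B_def)
  \<comment> \<open>The same vertices, with the edges reoriented by \<open>B\<close>: this auxiliary
    cycle makes \<open>backward_all\<close> available for \<open>B\<close>.\<close>
  interpret B: int_cycle "\<lparr> pverts = pverts D,
      parcs = {if B i then (X i, X (i + 1)) else (X (i + 1), X i) | i. True} \<rparr>" k X B
    by unfold_locales ((rule B_cong, assumption) | rule X_eq_iff | simp add: k3 verts)+
  obtain m where "s = X m" using assms(1) verts by (auto simp: source_iff)
  moreover have "F (m - 1)" using B.backward_all[OF \<open>B i\<close> step, of "m - 1"] by (simp add: B_def)
  ultimately show False using assms(1) unfolding source_iff by (auto simp: in_arc_iff)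
qed

lemma source_depth_exists:
  assumes "source D s" "v \<in> pverts D"
  shows "\<exists>n. source_depth D v n"
proof -
  interpret R: int_cycle D k "\<lambda>i. X (- i)" "\<lambda>i. \<not> F (- i - 1)" by (rule reflect)
  obtain i where v: "v = X i" using assms verts by auto
  consider "source D v" | "F (i - 1)" | "\<not> F i"
    unfolding v source_iff in_arc_iff by (auto simp: verts)
  then show ?thesis
  proof cases
    case 1 then show ?thesis by (intro exI[of _ 0]) (rule source_depth.source)
  next
    case 2 then show ?thesis using source_depth_exists_forward[OF assms(1)] v by fastforce
  next
    \<comment> \<open>In the reflected cycle the edge from \<open>X (i + 1)\<close> into
      \<open>X i\<close> is the forward edge \<open>- i - 1\<close>.\<close>
    case 3 then show ?thesis using R.source_depth_exists_forward[OF assms(1), of "- i - 1"] v by simp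
  qed
qed

lemma source_depth_source: "source D v \<Longrightarrow> source_depth D v n \<longleftrightarrow> n = 0"
  by (metis source_depth.simps source_iff)

lemma source_depth_nonsource:
  assumes "\<not> source D v"
  shows "source_depth D v n \<longleftrightarrow> (\<exists>u m. n = Suc m \<and> (u, v) \<in> parcs D \<and> source_depth D u m)"
  by (subst source_depth.simps) (use assms in auto)

text \<open>Walking backwards from a vertex that is not a sink leaves no choice: its in-arc is
  unique, and the tail of an arc is again not a sink.\<close>

lemma source_depth_unique:
  assumes "source_depth D v m" "source_depth D v n" "\<not> sink D v"
  shows "m = n"
  using assms
proof (induction arbitrary: n rule: source_depth.induct)
  case (source v)
  then show ?case by (simp add: source_depth_source)
next
  case (step u m v)
  have "\<not> source D v" using step.hyps by (auto simp: source_iff)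
  then obtain u' n' where u': "n = Suc n'" "(u', v) \<in> parcs D" "source_depth D u' n'"
    using step.prems source_depth_nonsource by blast
  have "u' = u" using unique_in_arc step u' arcs_verts by blast
  moreover have "\<not> sink D u" using step.hyps by (auto simp: sink_iff)
  ultimately show ?case using step.IH u' by simp
qed

lemma source_path_source_depth:
  assumes "source_path D s es u"
  shows "source_depth D u (length es)"
  using assms source_depth_walk[of D s 0 es u] source_depth.source
  unfolding source_path_iff by fastforce

text \<open>Appending an arc cannot close up the path, because depths are unique outside sinks.\<close>

lemma source_depth_source_path:
  assumes "source_depth D v n"
  shows "\<exists>s es. source_path D s es v \<and> length es = n \<and>
           (\<forall>w\<in>set (pawalk_verts s es). \<exists>m\<le>n. source_depth D w m)"
  using assms
proof (induction rule: source_depth.induct)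
  case (source v)
  then show ?case
    by (intro exI[of _ v] exI[of _ "[]"]) (auto simp: source_path_iff source_depth_source)
next
  case (step u n v)
  from step.IH obtain s es where es: "source_path D s es u" "length es = n"
    "\<forall>w\<in>set (pawalk_verts s es). \<exists>m\<le>n. source_depth D w m" by blast
  have d: "source_depth D v (Suc n)" using step.hyps by (rule source_depth.step)
  have u: "\<not> sink D u" using step.hyps by (auto simp: sink_iff)
  have v: "\<not> source D v" using step.hyps by (auto simp: source_iff)
  have ns: "\<not> sink D w" if "w \<in> set (pawalk_verts s es)" for w
    using that es(1) u unfolding source_path_iff by blast
  \<comment> \<open>This is what the third conjunct of the induction claim is for: the path visits
    only non-sinks of depth at most \<open>n\<close>, whereas \<open>v\<close> has depth
    \<open>Suc n\<close>.\<close>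
  have new: "v \<notin> set (pawalk_verts s es)"
    using ns[of v] es(3) source_depth_unique[OF d] by fastforce
  have "pcas s es u" using es(1) by (simp add: source_path_iff)
  note verts_snoc = pawalk_verts_snoc[OF this, of v]
  have "source_path D s (es @ [(u, v)]) v"
    using es(1) step.hyps new ns v unfolding source_path_iff verts_snoc pcas_snoc by auto
  moreover have "\<forall>w\<in>set (pawalk_verts s (es @ [(u, v)])). \<exists>m\<le>Suc n. source_depth D w m"
    unfolding verts_snoc using es(3) d by (auto intro: le_SucI)
  ultimately show ?case using es(2) by (intro exI[of _ s] exI[of _ "es @ [(u, v)]"]) auto
qed

text \<open>Replaces the paths of condition (ii) by depths, in terms of which the product arguments
  are carried out.\<close>

lemma even_source_distance_iff:
  "(\<exists>v n. neighboring_source D v u \<and> at_source_distance D v u n \<and> even n) \<longleftrightarrow>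
   (\<exists>n. source_depth D u n \<and> even n)"
  unfolding neighboring_source_def at_source_distance_def
  using source_path_source_depth source_depth_source_path by metis

text \<open>Away from sinks, parity alternates along the unique in-arc. The depths of a sink are one
  more than those of its two in-neighbours; as one of them is even, some in-neighbour has odd depth.
  If the other in-neighbour has even depth, it alone dominates the sink, which then also has an odd
  depth and is left out. If both are odd, the sink itself is chosen.\<close>

lemma ECD_set_source_depth:
  assumes "source D s"
    and even: "\<And>u. sink D u \<Longrightarrow> \<exists>n. source_depth D u n \<and> even n"
  shows "ECD_set D {v \<in> pverts D. \<forall>n. source_depth D v n \<longrightarrow> even n}" (is "ECD_set D ?S")
  unfolding ECD_set_iff[OF asym_arcs arcs_verts]
proof (intro conjI ballI)
  fix v assume v: "v \<in> pverts D"
  have arc: "u \<in> pverts D" "\<not> sink D u" if "(u, v) \<in> parcs D" for u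
    using that arcs_verts by (auto simp: sink_iff)
  \<comment> \<open>The choice is arbitrary at sinks, but \<open>depth\<close> is evaluated only at
    in-neighbours of \<open>v\<close>, which are not sinks and have just this one depth.\<close>
  obtain depth where depth: "source_depth D u (depth u)" if "u \<in> pverts D" for u
    using source_depth_exists[OF assms(1)] by metis
  have in_S: "u \<in> ?S \<longleftrightarrow> even (depth u)" if "(u, v) \<in> parcs D" for u
    using arc[OF that] depth source_depth_unique by blast
  have noloop: "(v, v) \<notin> parcs D" using asymD[OF asym_arcs] by blast
  consider "source D v" | "\<not> source D v" "\<not> sink D v" | "sink D v" "\<not> source D v" by blast
  then show "\<exists>!u. u \<in> ?S \<and> v \<in> closed_out_nbhd D u"
  proof cases
    case 1
    then show ?thesis
      using v by (intro ex1I[of _ v]) (auto simp: closed_out_nbhd_def source_depth_source source_iff)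
  next
    case 2
    then obtain u where u: "(u, v) \<in> parcs D" using v by (auto simp: source_iff)
    have uniq: "u' = u" if "(u', v) \<in> parcs D" for u'
      using unique_in_arc[OF v 2(2) that u] .
    have "source_depth D v (Suc (depth u))" using u arc depth source_depth.step by metis
    then have "source_depth D v n \<longleftrightarrow> n = Suc (depth u)" for n
      using source_depth_unique 2(2) by metis
    then have "v \<in> ?S \<longleftrightarrow> odd (depth u)"
      using v by simp
    then show ?thesis
      using in_S[OF u] uniq u noloop unfolding closed_out_nbhd_def
      by (smt (verit) insert_iff mem_Collect_eq)
  next
    case 3
    obtain a b where ab: "a \<noteq> b" "\<And>u. (u, v) \<in> parcs D \<longleftrightarrow> u = a \<or> u = b"
      using sink_in_arcs[OF 3(1)] by blast
    have sd: "source_depth D v n \<longleftrightarrow> n = Suc (depth a) \<or> n = Suc (depth b)" for n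
      unfolding source_depth_nonsource[OF 3(2)]
      using ab arc depth source_depth_unique by metis
    have vS: "v \<in> ?S \<longleftrightarrow> odd (depth a) \<and> odd (depth b)"
      using v sd by auto
    obtain n where n: "source_depth D v n" "even n" using even[OF 3(1)] by blast
    have "odd (depth a) \<or> odd (depth b)"
      using n(2) sd[of n, THEN iffD1, OF n(1)] by auto
    moreover have "a \<in> ?S \<longleftrightarrow> even (depth a)" "b \<in> ?S \<longleftrightarrow> even (depth b)"
      using in_S ab by blast+
    moreover have "a \<noteq> v" "b \<noteq> v" using noloop ab by auto
    ultimately show ?thesis
      using vS ab unfolding closed_out_nbhd_def by (smt (verit) insert_iff mem_Collect_eq)
  qed
qed auto

text \<open>Without sources, a forward edge is preceded by a forward edge, as otherwise both edges
  at their common vertex would point outwards. So one forward edge makes all edges forward; if there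
  is none, the reflected cycle has one.\<close>

lemma directed_cycle:
  assumes "\<And>v. \<not> source D v"
  shows "\<exists>Y. int_cycle D k Y (\<lambda>_. True)"
proof -
  have dir: "\<exists>Y. int_cycle D k Y (\<lambda>_. True)" if "int_cycle D k Y G" "G m" for Y G m
  proof -
    interpret Y: int_cycle D k Y G by fact
    have "G (i - 1)" if "G i" for i
    proof -
      obtain u where "(u, Y i) \<in> parcs D"
        using assms[of "Y i"] unfolding Y.source_iff by (auto simp: Y.verts)
      then show ?thesis using that unfolding Y.in_arc_iff by blast
    qed
    then have "G = (\<lambda>_. True)" using Y.backward_all[OF that(2)] by blast
    then show ?thesis using that(1) by (intro exI) simp
  qed
  show ?thesis
  proof (cases "\<exists>i. F i")
    case True
    then show ?thesis using dir[OF int_cycle_axioms] by blast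
  next
    case False
    then show ?thesis using dir[OF reflect, of 0] by simp
  qed
qed

end

lemma oriented_cycle_int_cycle:
  assumes "oriented_cycle D k p"
  obtains X F where "int_cycle D k X F"
proof -
  obtain x fwd where k: "k \<ge> 3" and x: "bij_betw x {..<k} (pverts D)"
    and a: "parcs D = {(if fwd i then (x i, x (Suc i mod k)) else (x (Suc i mod k), x i)) | i. i < k}"
    using assms unfolding oriented_cycle_def by blast
  \<comment> \<open>Reading indices modulo \<open>k\<close> turns the finite enumeration into a
    periodic one.\<close>
  define r where "r i = nat (i mod int k)" for i
  have r: "r i < k" for i using k by (simp add: r_def nat_less_iff)
  have r_nat: "r (int i) = i" if "i < k" for i using that by (simp add: r_def)
  have r_suc: "r (i + 1) = Suc (r i) mod k" for i
  proof -
    have "int (Suc (r i) mod k) = (i + 1) mod int k"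
      using k by (simp add: r_def zmod_int mod_simps add.commute)
    then show ?thesis unfolding r_def by (metis nat_int)
  qed
  have r_eq: "r i = r j \<longleftrightarrow> int k dvd i - j" for i j
    using k by (simp add: r_def mod_eq_dvd_iff[symmetric] eq_nat_nat_iff)
  have inj: "x (r i) = x (r j) \<longleftrightarrow> r i = r j" for i j
    using x r by (auto simp: bij_betw_def inj_on_def)
  have "int_cycle D k (\<lambda>i. x (r i)) (\<lambda>i. fwd (r i))"
  proof
    show "pverts D = range (\<lambda>i. x (r i))"
    proof -
      have "range r = {..<k}" using r r_nat by (auto simp: image_def) metis
      then show ?thesis using x by (metis bij_betw_def image_image)
    qed
    show "parcs D = {if fwd (r i) then (x (r i), x (r (i + 1))) else (x (r (i + 1)), x (r i)) |i. True}"
      (is "_ = ?R")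
    proof -
      have "?R = {(if fwd i then (x i, x (Suc i mod k)) else (x (Suc i mod k), x i)) | i. i < k}"
        unfolding r_suc using r r_nat by (intro Collect_cong) metis
      then show ?thesis using a by simp
    qed
    show "fwd (r i) = fwd (r j)" if "x (r i) = x (r j)" for i j
      using that by (simp add: inj)
  qed (simp_all add: k inj r_eq)
  then show thesis using that by blast
qed

section \<open>Direct products of digraphs\<close>

lemma arcs_product:
  "parcs (direct_product_family I C)
     \<subseteq> pverts (direct_product_family I C) \<times> pverts (direct_product_family I C)"
  by (auto simp: direct_product_family_def)

lemma verts_product: "f \<in> pverts (direct_product_family I C) \<longleftrightarrow>
   f \<in> extensional I \<and> (\<forall>i\<in>I. f i \<in> pverts (C i))"
  by (auto simp: direct_product_family_def PiE_iff)

context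
  fixes I :: "'i set" and C :: "'i \<Rightarrow> 'a pair_pre_digraph"
  assumes arcs_C: "\<And>i. i \<in> I \<Longrightarrow> parcs (C i) \<subseteq> pverts (C i) \<times> pverts (C i)"
    and asym_C: "\<And>i. i \<in> I \<Longrightarrow> asym (parcs (C i))"
begin

lemma arc_product_iff:
  "(f, g) \<in> parcs (direct_product_family I C) \<longleftrightarrow>
   f \<in> extensional I \<and> g \<in> extensional I \<and> (\<forall>i\<in>I. (f i, g i) \<in> parcs (C i))"
  using arcs_C by (auto simp: direct_product_family_def PiE_iff)

text \<open>Some index \<open>j\<close> is required: the empty product is a single vertex with a
  loop.\<close>

lemma asym_product:
  assumes "j \<in> I"
  shows "asym (parcs (direct_product_family I C))"
proof (rule asymI)
  fix f g assume "(f, g) \<in> parcs (direct_product_family I C)"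
  then have "(g j, f j) \<notin> parcs (C j)"
    using asymD[OF asym_C[OF assms]] assms by (auto simp: arc_product_iff)
  then show "(g, f) \<notin> parcs (direct_product_family I C)"
    using assms by (auto simp: arc_product_iff)
qed

text \<open>In-neighbours are chosen coordinate by coordinate. Outside \<open>j\<close> there is no
  choice, so fixing coordinate \<open>j\<close> fixes the in-neighbour.\<close>

lemma product_lift_in_arc:
  assumes "j \<in> I" and f: "f \<in> pverts (direct_product_family I C)"
    and pred: "\<And>i v. i \<in> I \<Longrightarrow> i \<noteq> j \<Longrightarrow> v \<in> pverts (C i) \<Longrightarrow> \<exists>!u. (u, v) \<in> parcs (C i)"
    and u: "(u, f j) \<in> parcs (C j)"
  shows "\<exists>!g. (g, f) \<in> parcs (direct_product_family I C) \<and> g j = u"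
proof -
  define q where "q i = (THE u. (u, f i) \<in> parcs (C i))" for i
  have pred_f: "\<exists>!u. (u, f i) \<in> parcs (C i)" if "i \<in> I" "i \<noteq> j" for i
    using that f by (intro pred) (simp_all add: verts_product)
  note q = theI'[OF pred_f, folded q_def]
  note q_unique = the1_equality[OF pred_f, folded q_def, symmetric]
  show ?thesis
  proof (rule ex1I[of _ "restrict (q(j := u)) I"])
    show "(restrict (q(j := u)) I, f) \<in> parcs (direct_product_family I C) \<and> restrict (q(j := u)) I j = u"
      using q u f \<open>j \<in> I\<close> by (auto simp: arc_product_iff verts_product)
  next
    fix g assume g: "(g, f) \<in> parcs (direct_product_family I C) \<and> g j = u"
    then have "g i = restrict (q(j := u)) I i" for i
      using q_unique[of i "g i"] by (cases "i \<in> I") (auto simp: arc_product_iff extensional_def)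
    then show "g = restrict (q(j := u)) I" by blast
  qed
qed

lemma ECD_digraph_pullback:
  assumes "j \<in> I"
    and pred: "\<And>i v. i \<in> I \<Longrightarrow> i \<noteq> j \<Longrightarrow> v \<in> pverts (C i) \<Longrightarrow> \<exists>!u. (u, v) \<in> parcs (C i)"
    and "ECD_set (C j) S"
  shows "ECD_digraph (direct_product_family I C)"
proof -
  let ?P = "direct_product_family I C"
  let ?T = "{f \<in> pverts ?P. f j \<in> S}"
  have S: "\<exists>!u. u \<in> S \<and> v \<in> closed_out_nbhd (C j) u" if "v \<in> pverts (C j)" for v
    using assms(3) that unfolding ECD_set_iff[OF asym_C[OF \<open>j \<in> I\<close>] arcs_C[OF \<open>j \<in> I\<close>]] by simp
  have noloop: "(v, v) \<notin> parcs (C j)" for v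
    using asymD[OF asym_C[OF \<open>j \<in> I\<close>]] by blast
  have proj: "(g j, f j) \<in> parcs (C j)" "g \<in> pverts ?P" if "(g, f) \<in> parcs ?P" for f g
    using that \<open>j \<in> I\<close> by (simp add: arc_product_iff) (use that arcs_product in blast)
  have "ECD_set ?P ?T"
    unfolding ECD_set_iff[OF asym_product[OF \<open>j \<in> I\<close>] arcs_product]
  proof (intro conjI ballI)
    fix f assume f: "f \<in> pverts ?P"
    then have "f j \<in> pverts (C j)" using \<open>j \<in> I\<close> by (simp add: verts_product)
    from S[OF this] obtain u where u: "u \<in> S" "f j = u \<or> (u, f j) \<in> parcs (C j)"
      and uniq: "\<And>u'. u' \<in> S \<Longrightarrow> f j = u' \<or> (u', f j) \<in> parcs (C j) \<Longrightarrow> u' = u"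
      unfolding closed_out_nbhd_def insert_iff mem_Collect_eq by metis
    show "\<exists>!g. g \<in> ?T \<and> f \<in> closed_out_nbhd ?P g"
    proof (cases "f j = u")
      case True
      \<comment> \<open>Here \<open>f\<close> dominates itself. A second dominator would lie over an
        in-neighbour of \<open>f j\<close> in \<open>S\<close>, which uniqueness in the factor
        forces to be \<open>f j\<close>, giving a loop.\<close>
      have "h = f" if h: "h \<in> ?T" "f \<in> closed_out_nbhd ?P h" for h
      proof (rule ccontr)
        assume "h \<noteq> f"
        then have "(h j, f j) \<in> parcs (C j)" using h proj(1) by (auto simp: closed_out_nbhd_def)
        moreover from this have "h j = f j" using uniq[of "h j"] h True by simp
        ultimately show False using noloop by simp
      qed
      then show ?thesis
        using u f True by (intro ex1I[of _ f]) (auto simp: closed_out_nbhd_def)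
    next
      case False
      then have "(u, f j) \<in> parcs (C j)" using u by blast
      from product_lift_in_arc[OF \<open>j \<in> I\<close> f pred this] obtain g
        where g: "(g, f) \<in> parcs ?P" "g j = u"
          and g': "\<And>h. (h, f) \<in> parcs ?P \<Longrightarrow> h j = u \<Longrightarrow> h = g" by metis
      show ?thesis
      proof (rule ex1I[of _ g])
        show "g \<in> ?T \<and> f \<in> closed_out_nbhd ?P g"
          using g u proj by (auto simp: closed_out_nbhd_def)
      next
        fix h assume "h \<in> ?T \<and> f \<in> closed_out_nbhd ?P h"
        then show "h = g"
          using uniq[of "h j"] False g' proj(1)[of h f] by (auto simp: closed_out_nbhd_def)
      qed
    qed
  qed auto
  then show ?thesis by (auto simp: ECD_digraph_def)
qed

lemma ECD_set_product:
  assumes "j \<in> I" "ECD_set (direct_product_family I C) S"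
  shows "ECD_digraph_set (direct_product_family I C) S"
  using assms arcs_product asym_product by unfold_locales auto

end

section \<open>Products of oriented cycles\<close>

locale oriented_cycle_family =
  fixes I :: "'i set" and C :: "'i \<Rightarrow> 'a pair_pre_digraph" and k p :: "'i \<Rightarrow> nat"
  assumes finite_I: "finite I"
    and cycle: "i \<in> I \<Longrightarrow> oriented_cycle (C i) (k i) (p i)"
begin

abbreviation "P \<equiv> direct_product_family I C"

lemma int_cycle:
  assumes "i \<in> I"
  obtains X F where "int_cycle (C i) (k i) X F"
  using oriented_cycle_int_cycle[OF cycle[OF assms]] by blast

lemma arcs_C: "i \<in> I \<Longrightarrow> parcs (C i) \<subseteq> pverts (C i) \<times> pverts (C i)"
  using int_cycle int_cycle.arcs_verts by metis

lemma asym_C: "i \<in> I \<Longrightarrow> asym (parcs (C i))"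
  using int_cycle int_cycle.asym_arcs by metis

lemma arc_P: "(f, g) \<in> parcs P \<longleftrightarrow>
    f \<in> extensional I \<and> g \<in> extensional I \<and> (\<forall>i\<in>I. (f i, g i) \<in> parcs (C i))"
  by (intro arc_product_iff arcs_C asym_C)

text \<open>Finiteness matters, because \<open>card\<close> is 0 on infinite sets as well.\<close>

lemma card_source_sink:
  assumes "i \<in> I"
  shows "p i = 0 \<longleftrightarrow> (\<forall>v. \<not> source (C i) v)" "p i = 0 \<longleftrightarrow> (\<forall>v. \<not> sink (C i) v)"
proof -
  obtain X F where "int_cycle (C i) (k i) X F" using int_cycle[OF assms] .
  then have "finite (pverts (C i))" by (rule int_cycle.finite_verts)
  then have "finite {v. source (C i) v}" "finite {v. sink (C i) v}"
    by (auto intro: finite_subset simp: source_def sink_def)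
  moreover have "p i = card {v. source (C i) v}" "p i = card {v. sink (C i) v}"
    using cycle[OF assms] unfolding oriented_cycle_def by (elim conjE, simp)+
  ultimately show "p i = 0 \<longleftrightarrow> (\<forall>v. \<not> source (C i) v)" "p i = 0 \<longleftrightarrow> (\<forall>v. \<not> sink (C i) v)"
    by (metis card_0_eq empty_Collect_eq)+
qed

text \<open>Existence comes from the absence of sources, uniqueness from the absence of
  sinks.\<close>

lemma pred_unique:
  assumes "i \<in> I" "p i = 0" "v \<in> pverts (C i)"
  shows "\<exists>!u. (u, v) \<in> parcs (C i)"
proof -
  obtain X F where "int_cycle (C i) (k i) X F" using int_cycle[OF assms(1)] .
  then interpret int_cycle "C i" "k i" X F .
  show ?thesis
    using card_source_sink[OF assms(1)] assms source_iff unique_in_arc by metis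
qed

section \<open>Necessity of the conditions\<close>

lemma not_ECD_two_sources:
  assumes "i \<in> I" "j \<in> I" "i \<noteq> j" "p i \<noteq> 0" "p j \<noteq> 0" "ECD_set P S"
  shows False
proof -
  interpret S: ECD_digraph_set P S
    by (rule ECD_set_product[OF arcs_C asym_C assms(1,6)])
  obtain X F where "int_cycle (C i) (k i) X F" using int_cycle[OF assms(1)] .
  then interpret i: int_cycle "C i" "k i" X F .
  obtain Y G where "int_cycle (C j) (k j) Y G" using int_cycle[OF assms(2)] .
  then interpret j: int_cycle "C j" "k j" Y G .
  obtain s where s: "source (C i) s" using assms card_source_sink by metis
  obtain m where "s = X m" using s i.verts by (auto simp: source_def)
  then obtain w where w: "(s, w) \<in> parcs (C i)"
    using s by (auto simp: i.source_iff i.in_arc_iff i.out_arc_iff)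
  obtain z where "sink (C j) z" using assms card_source_sink by metis
  then obtain c d where cd: "c \<noteq> d" "(c, z) \<in> parcs (C j)" "(d, z) \<in> parcs (C j)"
    using j.sink_in_arcs by metis
  have "\<exists>e. e \<in> parcs (C l)" if l: "l \<in> I" for l
  proof -
    obtain X F where "int_cycle (C l) (k l) X F" using int_cycle[OF l] .
    then show ?thesis by (simp add: int_cycle.arcs) blast
  qed
  \<comment> \<open>The coordinates other than \<open>i\<close> and \<open>j\<close> are filled with
    the ends of arbitrary arcs, tails in \<open>g c\<close> and heads in \<open>f\<close>, so that
    an arc in every factor results.\<close>
  then obtain e where e: "e l \<in> parcs (C l)" if "l \<in> I" for l by metis
  define g where "g c = restrict ((fst \<circ> e)(i := s, j := c)) I" for c
  define f where "f = restrict ((snd \<circ> e)(i := w, j := z)) I"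
  have arc: "(g c, f) \<in> parcs P" if "(c, z) \<in> parcs (C j)" for c
    using that e w \<open>i \<noteq> j\<close> by (auto simp: arc_P g_def f_def)
  have "g c i = s" for c using assms(1,3) by (simp add: g_def)
  \<comment> \<open>An in-arc of \<open>g c\<close> would give the source \<open>s\<close> an in-arc
    in coordinate \<open>i\<close>.\<close>
  then have "(h, g c) \<notin> parcs P" for h c
    using s assms(1) by (metis arc_P i.source_iff)
  then have mem: "g c \<in> S" if "(c, z) \<in> parcs (C j)" for c
    using arc[OF that] S.arcs_verts by (intro S.no_in_arc_mem) auto
  have "g c = g d" using S.in_arcs_mem_eq arc mem cd by blast
  then have "g c j = g d j" by simp
  then show False using cd(1) assms(2) by (simp add: g_def)
qed

text \<open>If all depths of \<open>z\<close> were odd, both its in-neighbours would have even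
  depth. A product vertex over \<open>z\<close> would then have an in-neighbour in \<open>S\<close>
  over each of them, hence two dominators.\<close>

lemma ECD_even_source_depth:
  assumes "j \<in> I" "p j \<noteq> 0" and dir: "\<And>i. i \<in> I \<Longrightarrow> i \<noteq> j \<Longrightarrow> p i = 0"
    and "ECD_set P S" "sink (C j) z"
  shows "\<exists>n. source_depth (C j) z n \<and> even n"
proof (rule ccontr)
  assume odd: "\<not> ?thesis"
  interpret S: ECD_digraph_set P S
    by (rule ECD_set_product[OF arcs_C asym_C assms(1,4)])
  obtain X F where "int_cycle (C j) (k j) X F" using int_cycle[OF assms(1)] .
  then interpret j: int_cycle "C j" "k j" X F .
  have lift: "\<exists>!g. (g, f) \<in> parcs P \<and> g j = u"
    if "f \<in> pverts P" "(u, f j) \<in> parcs (C j)" for f u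
    by (rule product_lift_in_arc[OF arcs_C asym_C assms(1) that(1) _ that(2)])
      (simp_all add: pred_unique dir)
  \<comment> \<open>The depth of coordinate \<open>j\<close> alone decides membership in
    \<open>S\<close>, because over a non-sink a product vertex has as many in-neighbours as its
    coordinate: none over a source, one otherwise.\<close>
  have parity: "f \<in> S \<longleftrightarrow> even n"
    if "source_depth (C j) v n" "\<not> sink (C j) v" "f \<in> pverts P" "f j = v" for v n f
    using that
  proof (induction arbitrary: f rule: source_depth.induct)
    case (source v)
    then have "(h, f) \<notin> parcs P" for h
      using \<open>j \<in> I\<close> by (metis arc_P j.source_iff)
    then show ?case
      using source.prems by (simp add: S.no_in_arc_mem)
  next
    case (step u n v)
    from lift[of f u] obtain g where g: "(g, f) \<in> parcs P" "g j = u"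
      and g_unique: "\<And>h. (h, f) \<in> parcs P \<Longrightarrow> h j = u \<Longrightarrow> h = g"
      using step.prems step.hyps by metis
    have "h = g" if h: "(h, f) \<in> parcs P" for h
    proof -
      have "(h j, v) \<in> parcs (C j)" using h step.prems \<open>j \<in> I\<close> by (auto simp: arc_P)
      then have "h j = u" using j.unique_in_arc step j.arcs_verts by blast
      then show ?thesis using h by (rule g_unique[rotated])
    qed
    then have "f \<in> S \<longleftrightarrow> g \<notin> S" using S.unique_in_arc_mem g by blast
    moreover have "g \<in> S \<longleftrightarrow> even n"
      using step.IH[of g] g step.hyps S.arcs_verts by (auto simp: j.sink_iff)
    ultimately show ?case by simp
  qed
  obtain s where s: "source (C j) s" using assms card_source_sink by metis
  have "\<exists>f. f \<in> pverts P \<and> f j = z"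
  proof -
    have "\<exists>v. v \<in> pverts (C i)" if "i \<in> I" for i
      using int_cycle[OF that] int_cycle.verts by (metis rangeI)
    then obtain q where "q i \<in> pverts (C i)" if "i \<in> I" for i by metis
    then show ?thesis
      using assms(1,5) by (intro exI[of _ "restrict (q(j := z)) I"]) (auto simp: verts_product sink_def)
  qed
  then obtain f where f: "f \<in> pverts P" "f j = z" by blast
  obtain a b where ab: "a \<noteq> b" "(a, z) \<in> parcs (C j)" "(b, z) \<in> parcs (C j)"
    using j.sink_in_arcs[OF assms(5)] by metis
  have up: "\<exists>g\<in>S. (g, f) \<in> parcs P \<and> g j = u" if u: "(u, z) \<in> parcs (C j)" for u
  proof -
    obtain g where g: "(g, f) \<in> parcs P" "g j = u"
      using lift[of f u] f u by blast
    have nonsink: "\<not> sink (C j) u" "u \<in> pverts (C j)"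
      using u j.arcs_verts by (auto simp: j.sink_iff)
    then obtain n where n: "source_depth (C j) u n" using j.source_depth_exists[OF s] by blast
    then have "even n" using odd source_depth.step[OF n u] by auto
    moreover have "g \<in> pverts P" using g S.arcs_verts by blast
    ultimately have "g \<in> S" using parity[OF n nonsink(1)] g(2) by simp
    then show ?thesis using g by blast
  qed
  from up[OF ab(2)] up[OF ab(3)] show False using S.in_arcs_mem_eq ab(1) by blast
qed

lemma ECD_directed_even:
  assumes "I \<noteq> {}" and dir: "\<And>i. i \<in> I \<Longrightarrow> p i = 0" and "ECD_set P S"
  shows "\<exists>i\<in>I. even (k i)"
proof (rule ccontr)
  assume "\<not> ?thesis"
  then have odd: "odd (\<Prod>i\<in>I. k i)" using finite_I by (simp add: even_prod_iff)
  obtain j where "j \<in> I" using assms by blast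
  interpret S: ECD_digraph_set P S
    by (rule ECD_set_product[OF arcs_C asym_C \<open>j \<in> I\<close> assms(3)])
  have "\<exists>Y. int_cycle (C i) (k i) Y (\<lambda>_. True)" if i: "i \<in> I" for i
    using int_cycle[OF i] int_cycle.directed_cycle card_source_sink(1)[OF i] dir[OF i] by metis
  then obtain Y where Y: "int_cycle (C i) (k i) (Y i) (\<lambda>_. True)" if "i \<in> I" for i by metis
  \<comment> \<open>The diagonal walk, advancing by one step in every coordinate at once.\<close>
  define f where "f n = restrict (\<lambda>i. Y i (int n)) I" for n :: nat
  have arc: "(f n, f (Suc n)) \<in> parcs P" for n
    using int_cycle.out_arc_iff[OF Y] by (simp add: f_def arc_P add.commute)
  have "h = f n" if "(h, f (Suc n)) \<in> parcs P" for h n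
  proof -
    have "h i = f n i" for i
    proof (cases "i \<in> I")
      case True
      then have arcs: "(h i, f (Suc n) i) \<in> parcs (C i)" "(f n i, f (Suc n) i) \<in> parcs (C i)"
        using that arc[of n] by (auto simp: arc_P)
      then have "f (Suc n) i \<in> pverts (C i)" using arcs_C[OF True] by blast
      from pred_unique[OF True dir[OF True] this] arcs show ?thesis by blast
    qed (use that arc[of n] in \<open>auto simp: arc_P extensional_def\<close>)
    then show ?thesis by blast
  qed
  then have "f (Suc n) \<in> S \<longleftrightarrow> f n \<notin> S" for n
    using S.unique_in_arc_mem arc by blast
  then have parity: "f n \<in> S \<longleftrightarrow> (even n \<longleftrightarrow> f 0 \<in> S)" for n
    by (induction n) auto
  \<comment> \<open>The product of the lengths is a common period of all coordinates. It is odd, so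
    the walk closes up against the alternation.\<close>
  have "f (\<Prod>i\<in>I. k i) i = f 0 i" for i
  proof (cases "i \<in> I")
    case True
    then have "int (k i) dvd int (\<Prod>i\<in>I. k i)"
      using finite_I by (simp add: dvd_prod_eqI del: of_nat_prod)
    then show ?thesis using True int_cycle.X_eq_iff[OF Y[OF True]] by (simp add: f_def)
  qed (simp add: f_def)
  then have "f (\<Prod>i\<in>I. k i) = f 0" by blast
  then show False using parity[of "\<Prod>i\<in>I. k i"] odd by simp
qed

section \<open>Sufficiency of the conditions\<close>

lemma ECD_digraph_if_even_cycle:
  assumes "j \<in> I" "even (k j)" and dir: "\<And>i. i \<in> I \<Longrightarrow> p i = 0"
  shows "ECD_digraph P"
proof -
  obtain Y where "int_cycle (C j) (k j) Y (\<lambda>_. True)"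
    using int_cycle[OF assms(1)] int_cycle.directed_cycle card_source_sink(1)[OF assms(1)]
      dir[OF assms(1)] by metis
  then interpret Y: int_cycle "C j" "k j" Y "\<lambda>_. True" .
  have one_of_two: "\<exists>!u. u \<in> T \<and> (u = a \<or> u = b)" if "a \<in> T \<longleftrightarrow> b \<notin> T"
    for a b :: 'a and T
    using that by metis
  \<comment> \<open>As \<open>k j\<close> is even, the parity of an index depends only on the
    vertex, so taking every second vertex is consistent around the cycle.\<close>
  have mem: "Y i \<in> Y ` {i. even i} \<longleftrightarrow> even i" for i
  proof
    assume "Y i \<in> Y ` {i. even i}"
    then obtain l where l: "even l" "int (k j) dvd i - l" by (auto simp: Y.X_eq_iff)
    have "even (i - l)" by (rule dvd_trans[OF _ l(2)]) (simp add: assms(2))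
    then show "even i" using l(1) by simp
  qed auto
  have "ECD_set (C j) (Y ` {i. even i})"
    unfolding ECD_set_iff[OF Y.asym_arcs Y.arcs_verts]
  proof (intro conjI ballI)
    fix v assume "v \<in> pverts (C j)"
    then obtain i where i: "v = Y i" using Y.verts by auto
    have nb: "v \<in> closed_out_nbhd (C j) u \<longleftrightarrow> u = Y i \<or> u = Y (i - 1)" for u
      unfolding i closed_out_nbhd_def by (auto simp: Y.in_arc_iff)
    show "\<exists>!u. u \<in> Y ` {i. even i} \<and> v \<in> closed_out_nbhd (C j) u"
      unfolding nb by (rule one_of_two) (use mem[of i] mem[of "i - 1"] in simp)
  qed (use Y.verts in auto)
  then show ?thesis
    by (rule ECD_digraph_pullback[OF arcs_C asym_C assms(1), rotated -1])
      (simp_all add: pred_unique dir)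
qed

lemma ECD_digraph_if_even_depths:
  assumes "j \<in> I" "p j \<noteq> 0" and dir: "\<And>i. i \<in> I \<Longrightarrow> i \<noteq> j \<Longrightarrow> p i = 0"
    and even: "\<And>u. sink (C j) u \<Longrightarrow> \<exists>n. source_depth (C j) u n \<and> even n"
  shows "ECD_digraph P"
proof -
  obtain X F where "int_cycle (C j) (k j) X F" using int_cycle[OF assms(1)] .
  then interpret j: int_cycle "C j" "k j" X F .
  obtain s where "source (C j) s" using assms card_source_sink by metis
  from j.ECD_set_source_depth[OF this even] show ?thesis
    by (rule ECD_digraph_pullback[OF arcs_C asym_C assms(1), rotated -1])
      (simp_all add: pred_unique dir)
qed

lemma even_source_distance_iff:
  assumes "j \<in> I"
  shows "(\<exists>v n. neighboring_source (C j) v u \<and> at_source_distance (C j) v u n \<and> even n) \<longleftrightarrow>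
    (\<exists>n. source_depth (C j) u n \<and> even n)"
  using int_cycle[OF assms] int_cycle.even_source_distance_iff by metis

end

section \<open>The characterization\<close>

theorem theorem8:
  fixes C :: "nat \<Rightarrow> 'a pair_pre_digraph" and k p :: "nat \<Rightarrow> nat" and t :: nat
  assumes "t \<ge> 1"
    and "\<And>i. i \<in> {1..t} \<Longrightarrow> oriented_cycle (C i) (k i) (p i)"
  shows "ECD_digraph (direct_product_family {1..t} C) \<longleftrightarrow>
    card {i \<in> {1..t}. p i \<noteq> 0} \<le> 1 \<and>
    ((\<forall>i\<in>{1..t}. p i = 0) \<longrightarrow> (\<exists>i\<in>{1..t}. even (k i))) \<and>
    (\<forall>j\<in>{1..t}. p j > 0 \<longrightarrow>
       (\<forall>u. sink (C j) u \<longrightarrow>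
          (\<exists>v n. neighboring_source (C j) v u \<and> at_source_distance (C j) v u n \<and> even n)))"
    (is "?E \<longleftrightarrow> ?card \<and> ?i \<and> ?ii")
proof -
  interpret oriented_cycle_family "{1..t}" C k p
    by unfold_locales (rule finite_atLeastAtMost, rule assms(2))
  have card: "?card \<longleftrightarrow> (\<forall>i\<in>{1..t}. \<forall>j\<in>{1..t}. p i \<noteq> 0 \<and> p j \<noteq> 0 \<longrightarrow> i = j)"
  proof -
    have "finite {i \<in> {1..t}. p i \<noteq> 0}" by simp
    from card_le_Suc0_iff_eq[OF this] show ?thesis
      unfolding One_nat_def[symmetric] by blast
  qed
  show ?thesis
  proof
    assume ?E
    then obtain S where S: "ECD_set P S" by (auto simp: ECD_digraph_def)
    have c: "i = j" if "i \<in> {1..t}" "j \<in> {1..t}" "p i \<noteq> 0" "p j \<noteq> 0" for i j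
      using not_ECD_two_sources[OF that(1,2) _ that(3,4) S] by blast
    have ?card unfolding card using c by blast
    moreover have ?i using ECD_directed_even[OF _ _ S] assms(1) by simp
    moreover have ?ii
    proof (intro ballI impI allI)
      fix j u assume j: "j \<in> {1..t}" "0 < p j" and u: "sink (C j) u"
      have "p i = 0" if "i \<in> {1..t}" "i \<noteq> j" for i
        using c[of i j] that j by auto
      then show "\<exists>v n. neighboring_source (C j) v u \<and> at_source_distance (C j) v u n \<and> even n"
        unfolding even_source_distance_iff[OF j(1)]
        using ECD_even_source_depth[OF j(1) _ _ S u] j(2) by auto
    qed
    ultimately show "?card \<and> ?i \<and> ?ii" by blast
  next
    assume R: "?card \<and> ?i \<and> ?ii"
    show ?E
    proof (cases "\<forall>i\<in>{1..t}. p i = 0")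
      case True
      then show ?thesis using R ECD_digraph_if_even_cycle by blast
    next
      case False
      then obtain j where j: "j \<in> {1..t}" "p j \<noteq> 0" by blast
      show ?thesis
      proof (rule ECD_digraph_if_even_depths[OF j])
        show "p i = 0" if "i \<in> {1..t}" "i \<noteq> j" for i
          using R that j unfolding card by blast
        show "\<exists>n. source_depth (C j) u n \<and> even n" if "sink (C j) u" for u
          unfolding even_source_distance_iff[OF j(1), symmetric] using R that j by blast
      qed
    qed
  qed
qed

end
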